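(* Let $\mathbb X=\langle X,\le\rangle$ be a partial order with $\mathbb X=\sum_{\mathbb I}\mathbb X_i$, where $\mathbb I=\langle n,\le_{\mathbb I}\rangle$ is a finite partial order on $n=\{0,\dots,n-1\}$, the $\mathbb X_i=\langle X_i,\le_i\rangle$ ($i<n$) are pairwise disjoint partial orders, and each $\mathbb X_i$ has a largest element $r_i=\max\mathbb X_i$. Put $\bar r=\langle r_0,\dots,r_{n-1}\rangle$. For $i<n$ let $\varphi_i(w_0,\dots,w_{n-1},v)$ be the $L_b$-formula $$v\le w_i\ \wedge\ \bigwedge_{j<_{\mathbb I}i} w_j<v\ \wedge\ \bigwedge_{j>_{\mathbb I}i} w_j>v\ \wedge\ \bigwedge_{j\ \text{incomparable to}\ i\ \text{in}\ \mathbb I}\big(\neg\, w_j\le v\wedge\neg\, v\le w_j\big),$$ and for a structure $\mathbb Y$ and $\bar a\in Y^n$ let $D_{\varphi_i(\bar a,v),\mathbb Y}=\{y\in Y:\mathbb Y\models\varphi_i[\bar a,y]\}$. Then: (a) $X_i=D_{\varphi_i(\bar r,v),\mathbb X}$ for each $i<n$; (b) the formula $\varepsilon(\bar r,u,v)=\bigvee_{i<n}(\varphi_i(\bar r,u)\wedge\varphi_i(\bar r,v))$ defines in $\mathbb X$ an equivalence relation on $X$ whose set of equivalence classes is $\{X_i:i<n\}$; (c) if $\mathbb Y\equiv\mathbb X$ and $\tau_i\in\mathrm{Th}(\mathbb X_i)$ for $i<n$, then there is $\bar r'=\langle r'_0,\dots,r'_{n-1}\rangle\in Y^n$ such that, setting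 $Y_i:=D_{\varphi_i(\bar r',v),\mathbb Y}$ for $i<n$ and $\mathbb Y_i$ the induced suborder on $Y_i$: (i) $\{Y_i:i<n\}$ is a partition of $Y$ and it is the set of classes of the equivalence relation defined in $\mathbb Y$ by $\varepsilon(\bar r',u,v)$; (ii) $\mathbb Y=\sum_{\mathbb I}\mathbb Y_i$ and $r'_i=\max\mathbb Y_i$ for each $i<n$; (iii) $\mathbb Y_i\models\tau_i$ for each $i<n$.
   Context: $L_b=\langle\le\rangle$ is the language of partial orders. Lexicographic sum: for a partial order $\mathbb I=\langle I,\le_{\mathbb I}\rangle$ and partial orders $\mathbb X_i$ ($i\in I$) with pairwise disjoint domains, $\sum_{\mathbb I}\mathbb X_i$ is the partial order on $X=\bigcup_{i\in I}X_i$ in which $x\le x'$ iff either $x,x'\in X_i$ for some $i$ and $x\le_{\mathbb X_i}x'$, or $x\in X_i$, $x'\in X_j$ for some $i,j$ with $i<_{\mathbb I}j$ (i.e. $i\le_{\mathbb I}j$, $i\ne j$). Here $w_j<v$ abbreviates $w_j\le v\wedge w_j\neq v$. *)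

theory Defs
  imports Main "HOL-Library.Disjoint_Sets"
begin

datatype fm =
    Fls
  | Eq nat nat
  | Le nat nat
  | Neg fm
  | And fm fm
  | Or fm fm
  | Forall nat fm
  | Exists nat fm

definition Less :: "nat \<Rightarrow> nat \<Rightarrow> fm" where
  "Less x y = And (Le x y) (Neg (Eq x y))"

definition BigAnd :: "fm list \<Rightarrow> fm" where
  "BigAnd fs = foldr And fs (Neg Fls)"

definition BigOr :: "fm list \<Rightarrow> fm" where
  "BigOr fs = foldr Or fs Fls"

primrec fv :: "fm \<Rightarrow> nat set" where
  "fv Fls = {}"
| "fv (Eq x y) = {x, y}"
| "fv (Le x y) = {x, y}"
| "fv (Neg f) = fv f"
| "fv (And f g) = fv f \<union> fv g"
| "fv (Or f g) = fv f \<union> fv g"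
| "fv (Forall x f) = fv f - {x}"
| "fv (Exists x f) = fv f - {x}"

definition sentence :: "fm \<Rightarrow> bool" where
  "sentence f \<longleftrightarrow> fv f = {}"

datatype 'a struct = Struct (universe: "'a set") (leq: "'a rel")

definition is_struct :: "'a struct \<Rightarrow> bool" where
  "is_struct M \<longleftrightarrow> leq M \<subseteq> universe M \<times> universe M"

definition poset :: "'a struct \<Rightarrow> bool" where
  "poset M \<longleftrightarrow> partial_order_on (universe M) (leq M)"

definition is_largest :: "'a struct \<Rightarrow> 'a \<Rightarrow> bool" where
  "is_largest M r \<longleftrightarrow> r \<in> universe M \<and> (\<forall>x \<in> universe M. (x, r) \<in> leq M)"

definition induced :: "'a struct \<Rightarrow> 'a set \<Rightarrow> 'a struct" where
  "induced M A = Struct A (leq M \<inter> A \<times> A)"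

primrec sat :: "'a struct \<Rightarrow> (nat \<Rightarrow> 'a) \<Rightarrow> fm \<Rightarrow> bool" where
  "sat M e Fls \<longleftrightarrow> False"
| "sat M e (Eq x y) \<longleftrightarrow> e x = e y"
| "sat M e (Le x y) \<longleftrightarrow> (e x, e y) \<in> leq M"
| "sat M e (Neg f) \<longleftrightarrow> \<not> sat M e f"
| "sat M e (And f g) \<longleftrightarrow> sat M e f \<and> sat M e g"
| "sat M e (Or f g) \<longleftrightarrow> sat M e f \<or> sat M e g"
| "sat M e (Forall x f) \<longleftrightarrow> (\<forall>a \<in> universe M. sat M (e(x := a)) f)"
| "sat M e (Exists x f) \<longleftrightarrow> (\<exists>a \<in> universe M. sat M (e(x := a)) f)"

text \<open>Only used for sentences, whose truth value does not depend on the assignment. Assignments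
  range over the whole type, so this also gives the expected meaning in an empty structure.\<close>

definition models :: "'a struct \<Rightarrow> fm \<Rightarrow> bool" (infix "\<Turnstile>" 50) where
  "M \<Turnstile> f \<longleftrightarrow> (\<forall>e. sat M e f)"

definition Th :: "'a struct \<Rightarrow> fm set" where
  "Th M = {f. sentence f \<and> M \<Turnstile> f}"

definition elem_equiv :: "'a struct \<Rightarrow> 'b struct \<Rightarrow> bool" where
  "elem_equiv M N \<longleftrightarrow> Th M = Th N"

text \<open>A tuple of parameters \<open>as\<close> of length \<open>n\<close> interprets the variables \<open>0, \<dots>, n - 1\<close>; the
  remaining free variables of the formula are \<open>n\<close> (and \<open>n + 1\<close>).\<close>

definition def_set :: "'a struct \<Rightarrow> 'a list \<Rightarrow> fm \<Rightarrow> 'a set" where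
  "def_set M as f = {y \<in> universe M. sat M (nth (as @ [y])) f}"

definition def_rel :: "'a struct \<Rightarrow> 'a list \<Rightarrow> fm \<Rightarrow> 'a rel" where
  "def_rel M as f = {(x, y). x \<in> universe M \<and> y \<in> universe M \<and> sat M (nth (as @ [x, y])) f}"

definition lex_sum :: "'i struct \<Rightarrow> ('i \<Rightarrow> 'a struct) \<Rightarrow> 'a struct" where
  "lex_sum I Xs = Struct (\<Union>i \<in> universe I. universe (Xs i))
     {(x, y). (\<exists>i \<in> universe I. x \<in> universe (Xs i) \<and> y \<in> universe (Xs i) \<and> (x, y) \<in> leq (Xs i)) \<or>
              (\<exists>i \<in> universe I. \<exists>j \<in> universe I. x \<in> universe (Xs i) \<and> y \<in> universe (Xs j) \<and>
                 (i, j) \<in> leq I \<and> i \<noteq> j)}"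

definition is_lex_sum :: "'a struct \<Rightarrow> 'i struct \<Rightarrow> ('i \<Rightarrow> 'a struct) \<Rightarrow> bool" where
  "is_lex_sum M I Xs \<longleftrightarrow>
     poset I \<and> (\<forall>i \<in> universe I. poset (Xs i)) \<and>
     disjoint_family_on (\<lambda>i. universe (Xs i)) (universe I) \<and> M = lex_sum I Xs"

text \<open>\<open>phi n I i v\<close> is the formula \<open>\<phi>\<^sub>i(w\<^sub>0, \<dots>, w\<^bsub>n-1\<^esub>, v)\<close>, where \<open>w\<^sub>j\<close> is the variable \<open>j\<close> and
  \<open>v\<close> is any variable.\<close>

definition phi :: "nat \<Rightarrow> nat struct \<Rightarrow> nat \<Rightarrow> nat \<Rightarrow> fm" where
  "phi n I i v =
     And (Le v i)
    (And (BigAnd [Less j v. j \<leftarrow> [0..<n], (j, i) \<in> leq I \<and> j \<noteq> i])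
    (And (BigAnd [Less v j. j \<leftarrow> [0..<n], (i, j) \<in> leq I \<and> j \<noteq> i])
         (BigAnd [And (Neg (Le j v)) (Neg (Le v j)).
                    j \<leftarrow> [0..<n], (i, j) \<notin> leq I \<and> (j, i) \<notin> leq I])))"

text \<open>The formula \<open>\<epsilon>(w\<^sub>0, \<dots>, w\<^bsub>n-1\<^esub>, u, v)\<close>, where \<open>u\<close> is the variable \<open>n\<close> and \<open>v\<close> is
  the variable \<open>n + 1\<close>.\<close>

definition eps :: "nat \<Rightarrow> nat struct \<Rightarrow> fm" where
  "eps n I = BigOr [And (phi n I i n) (phi n I i (n + 1)). i \<leftarrow> [0..<n]]"

end

theory Submission
  imports Defs
begin

text \<open>If a poset \<open>M\<close> with parameters \<open>w\<close> satisfies that every point lies in some \<open>D\<^sub>i\<close>, the set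
  defined by \<open>\<phi>\<^sub>i(w, v)\<close>, and that \<open>w\<^sub>i\<close> lies in \<open>D\<^sub>i\<close>, then \<open>M\<close> is the lexicographic sum of the
  \<open>D\<^sub>i\<close> and \<open>w\<^sub>i\<close> is the maximum of \<open>D\<^sub>i\<close>: for \<open>x\<close> in \<open>D\<^sub>i\<close> and \<open>y\<close> in \<open>D\<^sub>j\<close> with \<open>i < j\<close> we have
  \<open>x \<le> w\<^sub>i < y\<close>, and conversely \<open>x \<le> y \<le> w\<^sub>j\<close> excludes both \<open>j < i\<close> and \<open>i\<close>, \<open>j\<close> incomparable.
  These two conditions, the poset axioms and the relativizations of the \<open>\<tau>\<^sub>i\<close> to \<open>D\<^sub>i\<close> are first-order
  in \<open>w\<close>. Quantifying \<open>w\<close> existentially gives a sentence true in \<open>X\<close>, hence in \<open>Y\<close>.\<close>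

section \<open>Satisfaction, free variables and finite connectives\<close>

lemma sat_cong_fv: "(\<And>x. x \<in> fv f \<Longrightarrow> e x = e' x) \<Longrightarrow> sat M e f = sat M e' f"
proof (induction f arbitrary: e e')
  case (Forall x f)
  have "sat M (e(x := a)) f = sat M (e'(x := a)) f" for a
    by (rule Forall.IH) (use Forall.prems in auto)
  then show ?case by simp
next
  case (Exists x f)
  have "sat M (e(x := a)) f = sat M (e'(x := a)) f" for a
    by (rule Exists.IH) (use Exists.prems in auto)
  then show ?case by simp
next
  case (And f g)
  have "sat M e f = sat M e' f" "sat M e g = sat M e' g"
    by (rule And.IH; use And.prems in auto)+
  then show ?case by simp
next
  case (Or f g)
  have "sat M e f = sat M e' f" "sat M e g = sat M e' g"
    by (rule Or.IH; use Or.prems in auto)+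
  then show ?case by simp
next
  case (Neg f)
  have "sat M e f = sat M e' f"
    by (rule Neg.IH) (use Neg.prems in auto)
  then show ?case by simp
qed simp_all

text \<open>With no free variables all assignments agree, so any single one decides truth. This
  allows a sentence to be evaluated at an assignment that also carries the parameters.\<close>

lemma sentence_models_iff: "sentence f \<Longrightarrow> M \<Turnstile> f \<longleftrightarrow> sat M e f"
  unfolding models_def sentence_def using sat_cong_fv[of f] by blast

lemma sat_BigAnd [simp]: "sat M e (BigAnd fs) \<longleftrightarrow> (\<forall>f \<in> set fs. sat M e f)"
  unfolding BigAnd_def by (induction fs) auto

lemma sat_BigOr [simp]: "sat M e (BigOr fs) \<longleftrightarrow> (\<exists>f \<in> set fs. sat M e f)"
  unfolding BigOr_def by (induction fs) auto

lemma fv_BigAnd [simp]: "fv (BigAnd fs) = (\<Union>f \<in> set fs. fv f)"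
  unfolding BigAnd_def by (induction fs) auto

lemma fv_BigOr [simp]: "fv (BigOr fs) = (\<Union>f \<in> set fs. fv f)"
  unfolding BigOr_def by (induction fs) auto

section \<open>The sets cut out by the formulas \<open>phi\<close>\<close>

text \<open>The parameters form a function on all of \<open>nat\<close> instead of a list, so that a
  variable assignment can itself serve as the parameter tuple. For \<open>i < n\<close> only the
  values below \<open>n\<close> matter, which is \<open>phi_holds_cong\<close>.\<close>

definition phi_holds :: "'a struct \<Rightarrow> nat struct \<Rightarrow> nat \<Rightarrow> (nat \<Rightarrow> 'a) \<Rightarrow> nat \<Rightarrow> 'a \<Rightarrow> bool" where
  "phi_holds M I n w i y \<longleftrightarrow> (y, w i) \<in> leq M \<and>
     (\<forall>j<n. (j, i) \<in> leq I \<and> j \<noteq> i \<longrightarrow> (w j, y) \<in> leq M \<and> w j \<noteq> y) \<and>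
     (\<forall>j<n. (i, j) \<in> leq I \<and> j \<noteq> i \<longrightarrow> (y, w j) \<in> leq M \<and> y \<noteq> w j) \<and>
     (\<forall>j<n. (i, j) \<notin> leq I \<and> (j, i) \<notin> leq I \<longrightarrow> (w j, y) \<notin> leq M \<and> (y, w j) \<notin> leq M)"

definition cell :: "'a struct \<Rightarrow> nat struct \<Rightarrow> nat \<Rightarrow> (nat \<Rightarrow> 'a) \<Rightarrow> nat \<Rightarrow> 'a set" where
  "cell M I n w i = {y \<in> universe M. phi_holds M I n w i y}"

lemma sat_phi: "sat M e (phi n I i v) \<longleftrightarrow> phi_holds M I n e i (e v)"
  unfolding phi_def phi_holds_def Less_def by auto

lemma fv_phi: "i < n \<Longrightarrow> fv (phi n I i v) \<subseteq> insert v {..<n}"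
  unfolding phi_def Less_def by auto

lemma phi_holds_le: "phi_holds M I n w i y \<Longrightarrow> (y, w i) \<in> leq M"
  and phi_holds_below: "phi_holds M I n w i y \<Longrightarrow> j < n \<Longrightarrow> (j, i) \<in> leq I \<Longrightarrow> j \<noteq> i \<Longrightarrow>
    (w j, y) \<in> leq M \<and> w j \<noteq> y"
  and phi_holds_incomparable: "phi_holds M I n w i y \<Longrightarrow> j < n \<Longrightarrow> (i, j) \<notin> leq I \<Longrightarrow>
    (j, i) \<notin> leq I \<Longrightarrow> (y, w j) \<notin> leq M"
  unfolding phi_holds_def by simp_all

lemma phi_holds_cong:
  "i < n \<Longrightarrow> (\<And>j. j < n \<Longrightarrow> w j = w' j) \<Longrightarrow> phi_holds M I n w i y = phi_holds M I n w' i y"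
  unfolding phi_holds_def by auto

lemma cell_cong:
  "i < n \<Longrightarrow> (\<And>j. j < n \<Longrightarrow> w j = w' j) \<Longrightarrow> cell M I n w i = cell M I n w' i"
  unfolding cell_def using phi_holds_cong[of i n w w'] by simp

text \<open>The assignment \<open>nth (as @ [y])\<close> agrees with \<open>as\<close> below
  \<open>n\<close> and takes the value \<open>y\<close> at position \<open>n\<close>, the variable
  that plays \<open>v\<close>.\<close>

lemma def_set_phi:
  assumes "length as = n" "i < n"
  shows "def_set M as (phi n I i n) = cell M I n (nth as) i"
proof -
  have "phi_holds M I n (nth (as @ [y])) i y = phi_holds M I n (nth as) i y" for y
    using assms by (intro phi_holds_cong) (auto simp: nth_append)
  then show ?thesis
    using assms by (auto simp: def_set_def cell_def sat_phi nth_append)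
qed

lemma def_rel_eps:
  assumes "length as = n"
  shows "def_rel M as (eps n I)
    = {(x, y). \<exists>i<n. x \<in> cell M I n (nth as) i \<and> y \<in> cell M I n (nth as) i}"
proof -
  have "phi_holds M I n (nth (as @ [x, y])) i z = phi_holds M I n (nth as) i z"
    if "i < n" for x y z i
    using assms that by (intro phi_holds_cong) (auto simp: nth_append)
  then show ?thesis
    using assms by (auto simp: def_rel_def cell_def eps_def sat_phi nth_append)
qed

section \<open>Order relations between points of different cells\<close>

lemma poset_refl: "poset M \<Longrightarrow> x \<in> universe M \<Longrightarrow> (x, x) \<in> leq M"
  and poset_antisym: "poset M \<Longrightarrow> (x, y) \<in> leq M \<Longrightarrow> (y, x) \<in> leq M \<Longrightarrow> x = y"
  and poset_trans: "poset M \<Longrightarrow> (x, y) \<in> leq M \<Longrightarrow> (y, z) \<in> leq M \<Longrightarrow> (x, z) \<in> leq M"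
  and poset_carrier: "poset M \<Longrightarrow> (x, y) \<in> leq M \<Longrightarrow> x \<in> universe M \<and> y \<in> universe M"
  unfolding poset_def partial_order_on_def preorder_on_def
  by (auto dest: refl_onD antisymD transD)

lemma poset_induced:
  assumes "poset M" "A \<subseteq> universe M"
  shows "poset (induced M A)"
  unfolding poset_def partial_order_on_def preorder_on_def
proof (intro conjI)
  show "refl_on (universe (induced M A)) (leq (induced M A))"
    using assms(2) poset_refl[OF assms(1)] by (auto simp: induced_def refl_on_def)
  show "trans (leq (induced M A))"
    using poset_trans[OF assms(1)] by (intro transI) (auto simp: induced_def)
  show "antisym (leq (induced M A))"
    using poset_antisym[OF assms(1)] by (intro antisymI) (auto simp: induced_def)
qed (auto simp: induced_def)

text \<open>From \<open>x\<close> \<le> \<open>y\<close> \<le> \<open>w j\<close>: if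
  \<open>j\<close> were incomparable to \<open>i\<close>, then \<open>x\<close> \<le>
  \<open>w j\<close> would be forbidden; if \<open>j\<close> were strictly below \<open>i\<close>,
  then \<open>w j\<close> would lie strictly below \<open>x\<close>.\<close>

lemma phi_holds_leqD:
  assumes "poset M" "i < n" "j < n" "phi_holds M I n w i x" "phi_holds M I n w j y"
    and "(x, y) \<in> leq M"
  shows "i = j \<or> (i, j) \<in> leq I"
proof (rule ccontr)
  assume ne: "\<not> (i = j \<or> (i, j) \<in> leq I)"
  have xw: "(x, w j) \<in> leq M"
    by (rule poset_trans[OF assms(1,6) phi_holds_le[OF assms(5)]])
  then have "(j, i) \<in> leq I"
    using phi_holds_incomparable[OF assms(4,3)] ne by blast
  then have "(w j, x) \<in> leq M \<and> w j \<noteq> x"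
    using phi_holds_below[OF assms(4,3)] ne by blast
  then show False
    using poset_antisym[OF assms(1) xw] by simp
qed

text \<open>The parameter \<open>w i\<close> separates the two points: it bounds \<open>x\<close>
  from above and lies below \<open>y\<close>.\<close>

lemma phi_holds_leqI:
  assumes "poset M" "i < n" "phi_holds M I n w i x" "phi_holds M I n w j y"
    and "(i, j) \<in> leq I" "i \<noteq> j"
  shows "(x, y) \<in> leq M"
  using poset_trans[OF assms(1) phi_holds_le[OF assms(3)]] phi_holds_below[OF assms(4,2,5,6)]
  by simp

text \<open>Apply \<open>phi_holds_leqD\<close> to \<open>y\<close> \<le> \<open>y\<close> in both
  directions and use antisymmetry of \<open>I\<close>. Disjointness of the cells thus follows from
  the formulas alone.\<close>

lemma phi_holds_unique:
  assumes "poset M" "poset I" "i < n" "j < n"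
    and "phi_holds M I n w i y" "phi_holds M I n w j y"
  shows "i = j"
proof -
  have "(y, y) \<in> leq M"
    using poset_refl[OF assms(1)] poset_carrier[OF assms(1) phi_holds_le[OF assms(5)]] by blast
  then have "i = j \<or> (i, j) \<in> leq I" "j = i \<or> (j, i) \<in> leq I"
    using phi_holds_leqD[OF assms(1)] assms(3-6) by blast+
  then show ?thesis
    using poset_antisym[OF assms(2)] by blast
qed

lemma struct_eqI: "universe M = universe N \<Longrightarrow> leq M = leq N \<Longrightarrow> M = N"
  by (cases M; cases N) auto

section \<open>Posets covered by cells\<close>

text \<open>This is the common interface of both structures: the given sum \<open>X\<close>
  satisfies it with its maxima as \<open>w\<close>, and \<open>Y\<close> satisfies it with the
  parameters obtained by transfer.\<close>

locale cell_cover =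
  fixes M :: "'a struct" and I :: "nat struct" and n :: nat and w :: "nat \<Rightarrow> 'a"
  assumes poset_M: "poset M" and poset_I: "poset I" and index: "universe I = {..<n}"
    and cover: "x \<in> universe M \<Longrightarrow> \<exists>i<n. x \<in> cell M I n w i"
    and top_in_cell: "i < n \<Longrightarrow> w i \<in> cell M I n w i"
begin

lemma cell_subset: "cell M I n w i \<subseteq> universe M"
  unfolding cell_def by auto

lemma Union_cells: "(\<Union>i<n. cell M I n w i) = universe M"
  using cover cell_subset by blast

lemma cell_unique: "i < n \<Longrightarrow> j < n \<Longrightarrow> y \<in> cell M I n w i \<Longrightarrow> y \<in> cell M I n w j \<Longrightarrow> i = j"
  unfolding cell_def using phi_holds_unique[OF poset_M poset_I] by blast

lemma partition_cells: "partition_on (universe M) {cell M I n w i | i. i < n}"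
proof (rule partition_onI)
  show "\<Union> {cell M I n w i | i. i < n} = universe M"
    using Union_cells by blast
next
  fix p q assume "p \<in> {cell M I n w i | i. i < n}" "q \<in> {cell M I n w i | i. i < n}" "p \<noteq> q"
  then show "disjnt p q" using cell_unique unfolding disjnt_def by blast
next
  \<comment> \<open>Each block contains its own parameter \<open>w i\<close>.\<close>
  show "{} \<notin> {cell M I n w i | i. i < n}" using top_in_cell by blast
qed

text \<open>The set has the same shape as the right-hand side of \<open>def_rel_eps\<close>, so the
  facts below apply directly to the relation defined by \<open>eps\<close>.\<close>

abbreviation same_cell :: "'a rel" where
  "same_cell \<equiv> {(x, y). \<exists>i<n. x \<in> cell M I n w i \<and> y \<in> cell M I n w i}"

lemma equiv_same_cell: "equiv (universe M) same_cell"
proof (rule equivI)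
  show "same_cell \<subseteq> universe M \<times> universe M"
    using cell_subset by blast
  show "refl_on (universe M) same_cell"
    using cover unfolding refl_on_def by blast
  show "sym same_cell"
    unfolding sym_def by blast
  show "trans same_cell"
    using cell_unique unfolding trans_def by blast
qed

lemma same_cell_image: "i < n \<Longrightarrow> x \<in> cell M I n w i \<Longrightarrow> same_cell `` {x} = cell M I n w i"
  using cell_unique by blast

lemma quotient_same_cell: "universe M // same_cell = {cell M I n w i | i. i < n}"
proof (intro equalityI subsetI)
  fix p assume "p \<in> universe M // same_cell"
  then obtain x where x: "x \<in> universe M" "p = same_cell `` {x}"
    unfolding quotient_def by blast
  then obtain i where "i < n" "x \<in> cell M I n w i" using cover by blast
  then show "p \<in> {cell M I n w i | i. i < n}" using same_cell_image x by blast
next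
  fix p assume "p \<in> {cell M I n w i | i. i < n}"
  then obtain i where i: "i < n" "p = cell M I n w i" by blast
  \<comment> \<open>The parameter \<open>w i\<close> represents its cell, so every cell occurs as a
    class.\<close>
  then have "same_cell `` {w i} = p" using same_cell_image top_in_cell by blast
  moreover have "w i \<in> universe M" using i top_in_cell cell_subset by blast
  ultimately show "p \<in> universe M // same_cell" unfolding quotient_def by blast
qed

text \<open>Inside one cell the order is the induced one by definition. Between cells,
  \<open>phi_holds_leqD\<close> and \<open>phi_holds_leqI\<close> give the two directions of the
  comparison with \<open>I\<close>.\<close>

lemma is_lex_sum_cells: "is_lex_sum M I (\<lambda>i. induced M (cell M I n w i))"
proof -
  let ?L = "lex_sum I (\<lambda>i. induced M (cell M I n w i))"
  have "disjoint_family_on (\<lambda>i. universe (induced M (cell M I n w i))) (universe I)"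
    using cell_unique unfolding disjoint_family_on_def index induced_def by fastforce
  moreover have "M = ?L"
  proof (rule struct_eqI)
    show "universe M = universe ?L"
      using Union_cells by (simp add: lex_sum_def induced_def index)
    have "(x, y) \<in> leq M \<longleftrightarrow> (x, y) \<in> leq ?L" for x y
    proof
      assume xy: "(x, y) \<in> leq M"
      then obtain i j where ij: "i < n" "j < n" "x \<in> cell M I n w i" "y \<in> cell M I n w j"
        using poset_carrier[OF poset_M] cover by meson
      then have "i = j \<or> (i, j) \<in> leq I"
        using phi_holds_leqD[OF poset_M _ _ _ _ xy] unfolding cell_def by blast
      then show "(x, y) \<in> leq ?L"
        using ij xy by (auto simp: lex_sum_def induced_def index)
    next
      assume "(x, y) \<in> leq ?L"
      then consider "(x, y) \<in> leq M"
        | i j where "i < n" "j < n" "x \<in> cell M I n w i" "y \<in> cell M I n w j"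
            "(i, j) \<in> leq I" "i \<noteq> j"
        by (auto simp: lex_sum_def induced_def index)
      then show "(x, y) \<in> leq M"
        by cases (use phi_holds_leqI[OF poset_M] in \<open>auto simp: cell_def\<close>)
    qed
    then show "leq M = leq ?L" by auto
  qed
  ultimately show ?thesis
    unfolding is_lex_sum_def using poset_I poset_induced[OF poset_M cell_subset] by blast
qed

lemma is_largest_cell: "i < n \<Longrightarrow> is_largest (induced M (cell M I n w i)) (w i)"
  using top_in_cell unfolding is_largest_def induced_def
  by (auto simp: cell_def phi_holds_def)

end

section \<open>The summands of a given lexicographic sum are cells\<close>

text \<open>Disjointness makes the indices of \<open>x\<close> and \<open>y\<close> unique, so the
  existential quantifiers over indices in \<open>lex_sum\<close> collapse to \<open>i\<close> and
  \<open>j\<close>.\<close>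

lemma lex_sum_leq_iff:
  assumes "is_lex_sum X I Xs" "i \<in> universe I" "j \<in> universe I"
    and "x \<in> universe (Xs i)" "y \<in> universe (Xs j)"
  shows "(x, y) \<in> leq X \<longleftrightarrow> (if i = j then (x, y) \<in> leq (Xs i) else (i, j) \<in> leq I)"
proof -
  have disj: "k = l" if "k \<in> universe I" "l \<in> universe I"
    "z \<in> universe (Xs k)" "z \<in> universe (Xs l)" for k l z
    using assms(1) that unfolding is_lex_sum_def disjoint_family_on_def by blast
  have X: "(x, y) \<in> leq X \<longleftrightarrow>
      (\<exists>k \<in> universe I. x \<in> universe (Xs k) \<and> y \<in> universe (Xs k) \<and> (x, y) \<in> leq (Xs k)) \<or>
      (\<exists>k \<in> universe I. \<exists>l \<in> universe I. x \<in> universe (Xs k) \<and> y \<in> universe (Xs l) \<and>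
         (k, l) \<in> leq I \<and> k \<noteq> l)"
    using assms(1) unfolding is_lex_sum_def lex_sum_def by simp
  have xi: "k = i" if "k \<in> universe I" "x \<in> universe (Xs k)" for k
    using disj that assms(2,4) by blast
  have yj: "k = j" if "k \<in> universe I" "y \<in> universe (Xs k)" for k
    using disj that assms(3,5) by blast
  show ?thesis
  proof
    assume "(x, y) \<in> leq X"
    then show "if i = j then (x, y) \<in> leq (Xs i) else (i, j) \<in> leq I"
      unfolding X using xi yj by (elim disjE bexE conjE) simp_all
  next
    assume "if i = j then (x, y) \<in> leq (Xs i) else (i, j) \<in> leq I"
    then show "(x, y) \<in> leq X"
      unfolding X using assms(2-5) by (cases "i = j") auto
  qed
qed

text \<open>Relativized sentences speak about induced suborders, while the theories are given for
  the summands. Since \<open>leq (Xs i)\<close> has no pairs outside its universe, the two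
  structures are equal.\<close>

lemma induced_lex_sum_summand:
  assumes "is_lex_sum X I Xs" "i \<in> universe I"
  shows "induced X (universe (Xs i)) = Xs i"
proof (rule struct_eqI)
  have "poset (Xs i)" using assms unfolding is_lex_sum_def by blast
  then show "leq (induced X (universe (Xs i))) = leq (Xs i)"
    using lex_sum_leq_iff[OF assms(1) assms(2) assms(2)] poset_carrier[of "Xs i"]
    unfolding induced_def by auto
qed (simp add: induced_def)

text \<open>Points of a summand satisfy its formula by computing the order of the sum. Conversely, a
  point of cell \<open>i\<close> lies in some summand \<open>k\<close>, hence in cell
  \<open>k\<close>, and \<open>phi_holds_unique\<close> gives \<open>k = i\<close>.\<close>

lemma lex_sum_summand_eq_cell:
  assumes "poset X" "universe I = {..<n}" "is_lex_sum X I Xs" "i < n"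
    and top: "\<And>i. i < n \<Longrightarrow> is_largest (Xs i) (w i)"
  shows "universe (Xs i) = cell X I n w i"
proof -
  have w: "w j \<in> universe (Xs j)" if "j < n" for j
    using top[OF that] unfolding is_largest_def by blast
  have X: "universe X = (\<Union>i<n. universe (Xs i))"
    using assms(2,3) unfolding is_lex_sum_def lex_sum_def by auto
  have disj: "universe (Xs k) \<inter> universe (Xs l) = {}" if "k < n" "l < n" "k \<noteq> l" for k l
    using assms(2,3) that unfolding is_lex_sum_def disjoint_family_on_def by auto
  have poset_I: "poset I" using assms(3) unfolding is_lex_sum_def by blast
  have holds: "phi_holds X I n w k x" if k: "k < n" and x: "x \<in> universe (Xs k)" for k x
  proof -
    have le1: "(x, w j) \<in> leq X \<longleftrightarrow> (if k = j then (x, w j) \<in> leq (Xs k) else (k, j) \<in> leq I)"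
      if "j < n" for j
      by (rule lex_sum_leq_iff[OF assms(3)]) (use k x w that assms(2) in auto)
    have le2: "(w j, x) \<in> leq X \<longleftrightarrow> (if j = k then (w j, x) \<in> leq (Xs j) else (j, k) \<in> leq I)"
      if "j < n" for j
      by (rule lex_sum_leq_iff[OF assms(3)]) (use k x w that assms(2) in auto)
    have "(x, w k) \<in> leq (Xs k)"
      using top[OF k] x unfolding is_largest_def by blast
    moreover have "w j \<noteq> x" if "j < n" "j \<noteq> k" for j
      using disj[OF \<open>j < n\<close> k] that w x by blast
    \<comment> \<open>The incomparability clause does not mention \<open>j \<noteq> i\<close>;
      reflexivity makes it vacuous at \<open>j = k\<close>, where it would contradict
      \<open>x\<close> \<le> \<open>w k\<close>.\<close>
    moreover have "(k, k) \<in> leq I"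
      using poset_refl[OF poset_I] assms(2) k by blast
    ultimately show ?thesis
      unfolding phi_holds_def using k by (auto simp: le1 le2)
  qed
  show ?thesis
  proof (intro equalityI subsetI)
    fix x assume "x \<in> universe (Xs i)"
    then show "x \<in> cell X I n w i" using holds X \<open>i < n\<close> unfolding cell_def by blast
  next
    fix x assume x: "x \<in> cell X I n w i"
    then obtain k where "k < n" "x \<in> universe (Xs k)" using X unfolding cell_def by blast
    moreover from this have "k = i"
      using phi_holds_unique[OF assms(1) poset_I] holds x \<open>i < n\<close> unfolding cell_def by blast
    ultimately show "x \<in> universe (Xs i)" by blast
  qed
qed

lemma cell_cover_lex_sum:
  assumes "poset X" "universe I = {..<n}" "is_lex_sum X I Xs"
    and top: "\<And>i. i < n \<Longrightarrow> is_largest (Xs i) (w i)"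
  shows "cell_cover X I n w"
proof
  show "poset I" using assms(3) unfolding is_lex_sum_def by blast
  note eq = lex_sum_summand_eq_cell[OF assms(1-3) _ top]
  have "universe X = (\<Union>i<n. universe (Xs i))"
    using assms(2,3) unfolding is_lex_sum_def lex_sum_def by simp
  then show "\<exists>i<n. x \<in> cell X I n w i" if "x \<in> universe X" for x
    using that eq by blast
  show "w i \<in> cell X I n w i" if "i < n" for i
    using eq[OF that] top[OF that] unfolding is_largest_def by blast
qed fact+

section \<open>Existential closure over the parameters and relativization to a cell\<close>

primrec exists_first :: "nat \<Rightarrow> fm \<Rightarrow> fm" where
  "exists_first 0 f = f"
| "exists_first (Suc n) f = Exists n (exists_first n f)"

text \<open>The outermost quantifier of \<open>exists_first (Suc n) f\<close> changes the assignment
  at \<open>n\<close>, so the induction must leave \<open>e\<close> arbitrary.\<close>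

lemma sat_exists_first:
  "sat M e (exists_first n f) \<longleftrightarrow>
    (\<exists>w. (\<forall>j<n. w j \<in> universe M) \<and> sat M (\<lambda>k. if k < n then w k else e k) f)"
proof (induction n arbitrary: e)
  case (Suc n)
  have "sat M e (exists_first (Suc n) f) \<longleftrightarrow>
    (\<exists>a \<in> universe M. \<exists>w. (\<forall>j<n. w j \<in> universe M) \<and>
       sat M (\<lambda>k. if k < n then w k else (e(n := a)) k) f)"
    by (simp add: Suc)
  also have "\<dots> \<longleftrightarrow> (\<exists>w. (\<forall>j<Suc n. w j \<in> universe M) \<and>
       sat M (\<lambda>k. if k < Suc n then w k else e k) f)"
  proof
    assume "\<exists>a \<in> universe M. \<exists>w. (\<forall>j<n. w j \<in> universe M) \<and>
       sat M (\<lambda>k. if k < n then w k else (e(n := a)) k) f"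
    then obtain a w where aw: "a \<in> universe M" "\<forall>j<n. w j \<in> universe M"
       "sat M (\<lambda>k. if k < n then w k else (e(n := a)) k) f" by blast
    \<comment> \<open>The value at \<open>n\<close> moves from the outer assignment into the
      tuple.\<close>
    have "(\<lambda>k. if k < n then w k else (e(n := a)) k)
        = (\<lambda>k. if k < Suc n then (w(n := a)) k else e k)"
      by (auto simp: fun_eq_iff)
    then have "sat M (\<lambda>k. if k < Suc n then (w(n := a)) k else e k) f"
      using aw(3) by simp
    moreover have "\<forall>j<Suc n. (w(n := a)) j \<in> universe M"
      using aw by (simp add: less_Suc_eq)
    ultimately show "\<exists>w. (\<forall>j<Suc n. w j \<in> universe M) \<and>
       sat M (\<lambda>k. if k < Suc n then w k else e k) f" by blast
  next
    assume "\<exists>w. (\<forall>j<Suc n. w j \<in> universe M) \<and> sat M (\<lambda>k. if k < Suc n then w k else e k) f"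
    then obtain w where w: "\<forall>j<Suc n. w j \<in> universe M"
       "sat M (\<lambda>k. if k < Suc n then w k else e k) f" by blast
    have "(\<lambda>k. if k < Suc n then w k else e k) = (\<lambda>k. if k < n then w k else (e(n := w n)) k)"
      by (auto simp: fun_eq_iff less_Suc_eq)
    then have "sat M (\<lambda>k. if k < n then w k else (e(n := w n)) k) f"
      using w(2) by simp
    then show "\<exists>a \<in> universe M. \<exists>w. (\<forall>j<n. w j \<in> universe M) \<and>
       sat M (\<lambda>k. if k < n then w k else (e(n := a)) k) f"
      using w(1) by (meson lessI less_Suc_eq)
  qed
  finally show ?case .
qed simp

lemma fv_exists_first: "fv (exists_first n f) = fv f - {..<n}"
  by (induction n) (simp_all add: lessThan_Suc Diff_insert[of _ _ "{..<_}"])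

text \<open>The variables are shifted by \<open>n\<close> to keep them apart from the parameters \<open>w\<^sub>0, \<dots>, w\<^bsub>n-1\<^esub>\<close>.\<close>

primrec relativize :: "nat \<Rightarrow> nat struct \<Rightarrow> nat \<Rightarrow> fm \<Rightarrow> fm" where
  "relativize n I i Fls = Fls"
| "relativize n I i (Eq x y) = Eq (x + n) (y + n)"
| "relativize n I i (Le x y) = Le (x + n) (y + n)"
| "relativize n I i (Neg f) = Neg (relativize n I i f)"
| "relativize n I i (And f g) = And (relativize n I i f) (relativize n I i g)"
| "relativize n I i (Or f g) = Or (relativize n I i f) (relativize n I i g)"
| "relativize n I i (Forall x f) =
     Forall (x + n) (Or (Neg (phi n I i (x + n))) (relativize n I i f))"
| "relativize n I i (Exists x f) =
     Exists (x + n) (And (phi n I i (x + n)) (relativize n I i f))"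

lemma fv_relativize: "i < n \<Longrightarrow> fv (relativize n I i f) \<subseteq> {..<n} \<union> (\<lambda>x. x + n) ` fv f"
proof (induction f)
  case (Forall x f)
  then show ?case using fv_phi[of i n I "x + n"] by auto
next
  case (Exists x f)
  then show ?case using fv_phi[of i n I "x + n"] by auto
qed auto

text \<open>The tuple \<open>w\<close> is kept apart from \<open>e\<close> so that the cell stays
  fixed while quantifiers update \<open>e\<close>. Free variables must take values in the cell,
  because \<open>induced\<close> discards all other pairs and atoms \<open>Le\<close> would then
  differ.\<close>

lemma sat_relativize:
  assumes "i < n" "\<And>j. j < n \<Longrightarrow> e j = w j"
    and "\<And>x. x \<in> fv f \<Longrightarrow> e (x + n) \<in> cell M I n w i"
  shows "sat M e (relativize n I i f) \<longleftrightarrow> sat (induced M (cell M I n w i)) (\<lambda>x. e (x + n)) f"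
  using assms(2,3)
proof (induction f arbitrary: e)
  case (Le x y)
  then show ?case by (simp add: induced_def)
next
  case (And f g)
  then show ?case by simp
next
  case (Or f g)
  then show ?case by simp
next
  case (Forall x f)
  have shift: "(\<lambda>z. (e(x + n := a)) (z + n)) = (\<lambda>z. e (z + n))(x := a)" for a
    by (auto simp: fun_eq_iff)
  \<comment> \<open>Since \<open>x + n\<close> is at least \<open>n\<close>, the update leaves the
    parameters alone and the guard still defines the cell given by \<open>w\<close>.\<close>
  have phi: "a \<in> universe M \<Longrightarrow>
      sat M (e(x + n := a)) (phi n I i (x + n)) \<longleftrightarrow> a \<in> cell M I n w i" for a
    using phi_holds_cong[OF assms(1), of "e(x + n := a)" w] Forall.prems(1)
    by (simp add: sat_phi cell_def)
  have "sat M (e(x + n := a)) (relativize n I i f) \<longleftrightarrow>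
      sat (induced M (cell M I n w i)) ((\<lambda>z. e (z + n))(x := a)) f"
    if "a \<in> cell M I n w i" for a
    unfolding shift[symmetric] by (rule Forall.IH) (use Forall.prems that in auto)
  moreover have "cell M I n w i \<subseteq> universe M" "universe (induced M (cell M I n w i)) = cell M I n w i"
    by (auto simp: cell_def induced_def)
  ultimately show ?case
    using phi unfolding relativize.simps sat.simps by blast
next
  case (Exists x f)
  have shift: "(\<lambda>z. (e(x + n := a)) (z + n)) = (\<lambda>z. e (z + n))(x := a)" for a
    by (auto simp: fun_eq_iff)
  have phi: "a \<in> universe M \<Longrightarrow>
      sat M (e(x + n := a)) (phi n I i (x + n)) \<longleftrightarrow> a \<in> cell M I n w i" for a
    using phi_holds_cong[OF assms(1), of "e(x + n := a)" w] Exists.prems(1)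
    by (simp add: sat_phi cell_def)
  have "sat M (e(x + n := a)) (relativize n I i f) \<longleftrightarrow>
      sat (induced M (cell M I n w i)) ((\<lambda>z. e (z + n))(x := a)) f"
    if "a \<in> cell M I n w i" for a
    unfolding shift[symmetric] by (rule Exists.IH) (use Exists.prems that in auto)
  moreover have "cell M I n w i \<subseteq> universe M" "universe (induced M (cell M I n w i)) = cell M I n w i"
    by (auto simp: cell_def induced_def)
  ultimately show ?case
    using phi unfolding relativize.simps sat.simps by blast
qed simp_all

text \<open>A sentence makes the condition on free variables vacuous, so \<open>w\<close> can serve
  both as assignment and as parameter tuple.\<close>

lemma sat_relativize_sentence:
  assumes "i < n" "sentence f"
  shows "sat M w (relativize n I i f) \<longleftrightarrow> induced M (cell M I n w i) \<Turnstile> f"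
proof -
  have "sat M w (relativize n I i f) \<longleftrightarrow>
      sat (induced M (cell M I n w i)) (\<lambda>x. w (x + n)) f"
    using assms by (intro sat_relativize) (auto simp: sentence_def)
  then show ?thesis
    by (simp only: sentence_models_iff[OF assms(2), of _ "\<lambda>x. w (x + n)"])
qed

section \<open>The decomposition as a sentence, and its transfer\<close>

definition poset_fm :: fm where
  "poset_fm =
    And (Forall 0 (Le 0 0))
   (And (Forall 0 (Forall 1 (Or (Neg (And (Le 0 1) (Le 1 0))) (Eq 0 1))))
        (Forall 0 (Forall 1 (Forall 2 (Or (Neg (And (Le 0 1) (Le 1 2))) (Le 0 2))))))"

text \<open>The predicates \<open>antisym\<close> and \<open>trans\<close> range over the whole
  type, the formula only over the universe. The hypothesis \<open>is_struct\<close> bridges this and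
  supplies the inclusion of \<open>leq M\<close> in the square of the universe.\<close>

lemma sat_poset_fm:
  assumes "is_struct M"
  shows "sat M e poset_fm \<longleftrightarrow> poset M"
proof -
  have "sat M e poset_fm \<longleftrightarrow> refl_on (universe M) (leq M) \<and>
    (\<forall>x \<in> universe M. \<forall>y \<in> universe M. (x, y) \<in> leq M \<and> (y, x) \<in> leq M \<longrightarrow> x = y) \<and>
    (\<forall>x \<in> universe M. \<forall>y \<in> universe M. \<forall>z \<in> universe M.
       (x, y) \<in> leq M \<and> (y, z) \<in> leq M \<longrightarrow> (x, z) \<in> leq M)"
    by (simp add: poset_fm_def refl_on_def, blast)
  moreover have "antisym (leq M) \<longleftrightarrow>
    (\<forall>x \<in> universe M. \<forall>y \<in> universe M. (x, y) \<in> leq M \<and> (y, x) \<in> leq M \<longrightarrow> x = y)"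
    using assms unfolding is_struct_def antisym_def by blast
  moreover have "trans (leq M) \<longleftrightarrow>
    (\<forall>x \<in> universe M. \<forall>y \<in> universe M. \<forall>z \<in> universe M.
       (x, y) \<in> leq M \<and> (y, z) \<in> leq M \<longrightarrow> (x, z) \<in> leq M)"
    using assms unfolding is_struct_def trans_def by blast
  ultimately show ?thesis
    using assms unfolding is_struct_def poset_def partial_order_on_def preorder_on_def by argo
qed

text \<open>In \<open>phi n I i i\<close> the parameter variable \<open>i\<close> also takes the
  place of \<open>v\<close>, so the formula is asserted of \<open>w i\<close> itself. The variables
  0, 1, 2 of \<open>poset_fm\<close> may coincide with parameters because they are all bound
  there.\<close>

definition decomposition_fm :: "nat \<Rightarrow> nat struct \<Rightarrow> (nat \<Rightarrow> fm) \<Rightarrow> fm" where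
  "decomposition_fm n I \<tau> =
    And poset_fm
   (And (Forall n (BigOr [phi n I i n. i \<leftarrow> [0..<n]]))
   (And (BigAnd [phi n I i i. i \<leftarrow> [0..<n]])
        (BigAnd [relativize n I i (\<tau> i). i \<leftarrow> [0..<n]])))"

lemma sat_decomposition_fm:
  assumes "is_struct M" "poset I" "universe I = {..<n}"
    and w: "\<And>i. i < n \<Longrightarrow> w i \<in> universe M"
    and \<tau>: "\<And>i. i < n \<Longrightarrow> sentence (\<tau> i)"
  shows "sat M w (decomposition_fm n I \<tau>) \<longleftrightarrow>
    cell_cover M I n w \<and> (\<forall>i<n. induced M (cell M I n w i) \<Turnstile> \<tau> i)"
proof -
  \<comment> \<open>The covering condition quantifies variable \<open>n\<close>, just past the
    parameters, so the update does not affect them.\<close>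
  have "phi_holds M I n (w(n := x)) i x = phi_holds M I n w i x" if "i < n" for i x
    by (rule phi_holds_cong) (use that in auto)
  then have "sat M w (Forall n (BigOr [phi n I i n. i \<leftarrow> [0..<n]])) \<longleftrightarrow>
      (\<forall>x \<in> universe M. \<exists>i<n. x \<in> cell M I n w i)"
    by (auto simp: sat_phi cell_def Bex_def)
  moreover have "sat M w (BigAnd [phi n I i i. i \<leftarrow> [0..<n]]) \<longleftrightarrow>
      (\<forall>i<n. w i \<in> cell M I n w i)"
    using w by (auto simp: sat_phi cell_def)
  moreover have "sat M w (BigAnd [relativize n I i (\<tau> i). i \<leftarrow> [0..<n]]) \<longleftrightarrow>
      (\<forall>i<n. induced M (cell M I n w i) \<Turnstile> \<tau> i)"
    by (auto simp: sat_relativize_sentence \<tau>)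
  ultimately show ?thesis
    unfolding decomposition_fm_def cell_cover_def using sat_poset_fm[OF assms(1)] assms(2,3)
    by (simp add: Ball_def)
qed

lemma sentence_decomposition:
  assumes "\<And>i. i < n \<Longrightarrow> sentence (\<tau> i)"
  shows "sentence (exists_first n (decomposition_fm n I \<tau>))"
proof -
  have phi: "fv (phi n I i n) \<subseteq> insert n {..<n}" "fv (phi n I i i) \<subseteq> {..<n}" if "i < n" for i
    using fv_phi[OF that, of I n] fv_phi[OF that, of I i] that by auto
  have rel: "fv (relativize n I i (\<tau> i)) \<subseteq> {..<n}" if "i < n" for i
    using fv_relativize[OF that, of I "\<tau> i"] assms[OF that] unfolding sentence_def by simp
  have "fv poset_fm = {}"
    by (auto simp: poset_fm_def)
  moreover have "fv (Forall n (BigOr [phi n I i n. i \<leftarrow> [0..<n]])) \<subseteq> {..<n}"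
    using phi(1) by (simp add: Diff_subset_conv UN_subset_iff)
  moreover have "fv (BigAnd [phi n I i i. i \<leftarrow> [0..<n]]) \<subseteq> {..<n}"
    using phi(2) by (simp add: UN_subset_iff)
  moreover have "fv (BigAnd [relativize n I i (\<tau> i). i \<leftarrow> [0..<n]]) \<subseteq> {..<n}"
    using rel by (simp add: UN_subset_iff)
  ultimately have "fv (decomposition_fm n I \<tau>) \<subseteq> {..<n}"
    unfolding decomposition_fm_def fv.simps(5) by (intro Un_least) simp_all
  then show ?thesis unfolding sentence_def fv_exists_first by blast
qed

text \<open>Elementary equivalence enters here only: the existence of suitable parameters is one
  sentence, which can be read in structures over different types.\<close>

lemma elem_equiv_decomposition:
  assumes X: "cell_cover X I n w" "\<And>i. i < n \<Longrightarrow> induced X (cell X I n w i) \<Turnstile> \<tau> i"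
    and \<tau>: "\<And>i. i < n \<Longrightarrow> sentence (\<tau> i)"
    and Y: "is_struct Y" "elem_equiv Y X"
  obtains w' where "cell_cover Y I n w'" "\<And>i. i < n \<Longrightarrow> w' i \<in> universe Y"
    "\<And>i. i < n \<Longrightarrow> induced Y (cell Y I n w' i) \<Turnstile> \<tau> i"
proof -
  interpret cell_cover X I n w by fact
  let ?f = "decomposition_fm n I \<tau>"
  have struct_X: "is_struct X"
    using poset_carrier[OF poset_M] unfolding is_struct_def by auto
  have w: "w i \<in> universe X" if "i < n" for i
    using top_in_cell[OF that] cell_subset by blast
  have "sat X w ?f"
    using sat_decomposition_fm[OF struct_X poset_I index, of w \<tau>] w \<tau> X by simp
  \<comment> \<open>The maxima \<open>w\<close> are the witnesses; filling up with \<open>w\<close>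
    again from \<open>n\<close> on gives back the assignment \<open>w\<close>.\<close>
  then have "sat X w (exists_first n ?f)"
    unfolding sat_exists_first using w by (intro exI[of _ w]) simp
  then have "exists_first n ?f \<in> Th X"
    using sentence_decomposition[of n \<tau> I] \<tau> sentence_models_iff unfolding Th_def by blast
  then have "Y \<Turnstile> exists_first n ?f"
    using Y(2) unfolding elem_equiv_def Th_def by blast
  then obtain e v where v: "\<forall>j<n. v j \<in> universe Y" "sat Y (\<lambda>k. if k < n then v k else e k) ?f"
    unfolding models_def sat_exists_first by blast
  \<comment> \<open>The witnesses \<open>v\<close> matter below \<open>n\<close>; from
    \<open>n\<close> on the tuple takes the values of the assignment \<open>e\<close>, which need
    not lie in the universe.\<close>
  let ?w = "\<lambda>k. if k < n then v k else e k"
  have w': "?w i \<in> universe Y" if "i < n" for i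
    using v that by simp
  have "cell_cover Y I n ?w \<and> (\<forall>i<n. induced Y (cell Y I n ?w i) \<Turnstile> \<tau> i)"
    using sat_decomposition_fm[OF Y(1) poset_I index, of ?w \<tau>] v(2) w' \<tau> by simp
  then show thesis
    using w' by (intro that[of ?w]) simp_all
qed

section \<open>Parts (a), (b) and (c) from the cells\<close>

theorem theorem3p1:
  fixes X :: "'a struct" and n :: nat and I :: "nat struct"
    and Xs :: "nat \<Rightarrow> 'a struct" and rs :: "'a list"
  assumes "poset X"
    and "poset I" and "universe I = {..<n}"
    and "\<And>i. i < n \<Longrightarrow> poset (Xs i)"
    and "is_lex_sum X I Xs"
    and "length rs = n"
    and "\<And>i. i < n \<Longrightarrow> is_largest (Xs i) (rs ! i)"
  shows "(\<forall>i<n. universe (Xs i) = def_set X rs (phi n I i n))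
    \<and> (equiv (universe X) (def_rel X rs (eps n I)) \<and>
       universe X // def_rel X rs (eps n I) = {universe (Xs i) | i. i < n})
    \<and> (\<forall>(Y :: 'b struct) (\<tau> :: nat \<Rightarrow> fm).
         is_struct Y \<and> elem_equiv Y X \<and> (\<forall>i<n. \<tau> i \<in> Th (Xs i)) \<longrightarrow>
         (\<exists>rs' :: 'b list. length rs' = n \<and> set rs' \<subseteq> universe Y \<and>
           (let Ys = (\<lambda>i. def_set Y rs' (phi n I i n)) in
              (partition_on (universe Y) {Ys i | i. i < n} \<and>
               equiv (universe Y) (def_rel Y rs' (eps n I)) \<and>
               universe Y // def_rel Y rs' (eps n I) = {Ys i | i. i < n})
            \<and> (is_lex_sum Y I (\<lambda>i. induced Y (Ys i)) \<and>
               (\<forall>i<n. is_largest (induced Y (Ys i)) (rs' ! i)))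
            \<and> (\<forall>i<n. induced Y (Ys i) \<Turnstile> \<tau> i))))"
proof -
  note top = assms(7)
  have cells: "universe (Xs i) = cell X I n (nth rs) i" if "i < n" for i
    using lex_sum_summand_eq_cell[OF assms(1,3,5) that top] by blast
  have cover: "cell_cover X I n (nth rs)"
    using cell_cover_lex_sum[OF assms(1,3,5) top] by blast
  have a: "\<forall>i<n. universe (Xs i) = def_set X rs (phi n I i n)"
    using cells def_set_phi[OF assms(6)] by metis
  have "{universe (Xs i) | i. i < n} = {cell X I n (nth rs) i | i. i < n}"
    unfolding setcompr_eq_image by (rule image_cong) (simp_all add: cells)
  then have b: "equiv (universe X) (def_rel X rs (eps n I))"
    "universe X // def_rel X rs (eps n I) = {universe (Xs i) | i. i < n}"
    unfolding def_rel_eps[OF assms(6)]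
    using cell_cover.equiv_same_cell[OF cover] cell_cover.quotient_same_cell[OF cover]
    by simp_all
  have c: "\<exists>rs' :: 'b list. length rs' = n \<and> set rs' \<subseteq> universe Y \<and>
      (let Ys = (\<lambda>i. def_set Y rs' (phi n I i n)) in
         (partition_on (universe Y) {Ys i | i. i < n} \<and>
          equiv (universe Y) (def_rel Y rs' (eps n I)) \<and>
          universe Y // def_rel Y rs' (eps n I) = {Ys i | i. i < n})
       \<and> (is_lex_sum Y I (\<lambda>i. induced Y (Ys i)) \<and>
          (\<forall>i<n. is_largest (induced Y (Ys i)) (rs' ! i)))
       \<and> (\<forall>i<n. induced Y (Ys i) \<Turnstile> \<tau> i))"
    if Y: "is_struct Y" "elem_equiv Y X" and \<tau>: "\<forall>i<n. \<tau> i \<in> Th (Xs i)"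
    for Y :: "'b struct" and \<tau>
  proof -
    have "induced X (cell X I n (nth rs) i) \<Turnstile> \<tau> i" if "i < n" for i
      using induced_lex_sum_summand[OF assms(5), of i] cells[OF that] \<tau> that assms(3)
      unfolding Th_def by simp
    moreover have "sentence (\<tau> i)" if "i < n" for i
      using \<tau> that unfolding Th_def by blast
    ultimately obtain w where w: "cell_cover Y I n w" "\<And>i. i < n \<Longrightarrow> w i \<in> universe Y"
      "\<And>i. i < n \<Longrightarrow> induced Y (cell Y I n w i) \<Turnstile> \<tau> i"
      using elem_equiv_decomposition[OF cover _ _ Y, of \<tau>] by blast
    \<comment> \<open>Cutting \<open>w\<close> to a list keeps only the values below
      \<open>n\<close>, and by \<open>cell_cong\<close> these determine the cells.\<close>
    define rs' where "rs' = map w [0..<n]"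
    have len: "length rs' = n" by (simp add: rs'_def)
    have nth: "rs' ! i = w i" if "i < n" for i using that by (simp add: rs'_def)
    have cell: "cell Y I n (nth rs') i = cell Y I n w i" if "i < n" for i
      using cell_cong[OF that] nth by blast
    have Ys: "def_set Y rs' (phi n I i n) = cell Y I n w i" if "i < n" for i
      using def_set_phi[OF len that] cell[OF that] by simp
    have classes: "{def_set Y rs' (phi n I i n) | i. i < n} = {cell Y I n w i | i. i < n}"
      unfolding setcompr_eq_image by (rule image_cong) (simp_all add: Ys)
    have rel: "def_rel Y rs' (eps n I) =
        {(x, y). \<exists>i<n. x \<in> cell Y I n w i \<and> y \<in> cell Y I n w i}"
      unfolding def_rel_eps[OF len] using cell by auto
    \<comment> \<open>The two families of summands are only known to agree below \<open>n\<close>.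
      That is enough, since \<open>is_lex_sum\<close> evaluates them on \<open>universe I\<close>
      only.\<close>
    have "is_lex_sum Y I (\<lambda>i. induced Y (def_set Y rs' (phi n I i n))) \<longleftrightarrow>
        is_lex_sum Y I (\<lambda>i. induced Y (cell Y I n w i))"
      unfolding is_lex_sum_def lex_sum_def disjoint_family_on_def assms(3) using Ys by simp
    then have "is_lex_sum Y I (\<lambda>i. induced Y (def_set Y rs' (phi n I i n)))"
      using cell_cover.is_lex_sum_cells[OF w(1)] by blast
    moreover have "set rs' \<subseteq> universe Y" using w(2) by (auto simp: rs'_def)
    ultimately show ?thesis
      unfolding Let_def
      using len nth Ys w(3) cell_cover.partition_cells[OF w(1)] cell_cover.equiv_same_cell[OF w(1)]
        cell_cover.quotient_same_cell[OF w(1)] cell_cover.is_largest_cell[OF w(1)]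
      by (intro exI[of _ rs']) (simp add: classes rel)
  qed
  show ?thesis
    by (intro conjI a b allI impI; elim conjE; rule c)
qed

end
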